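(* Let $n$ be a positive integer. Every odd integer in $[2^n+1, 2^{n+1}]$ has a unique chain $C_n$; that is, if $L$ and $M$ are two distinct odd integers in $[2^n+1,2^{n+1}]$, then the chains $C_n(L)$ and $C_n(M)$ are not identical.
   Context: Let $A(x) = 3x+1$ and $B(x) = x/2$. The chain of a positive integer $L$ is obtained by iterating the Collatz rule: if the current number is even, apply $B$; if it is odd, apply $A$ and then $B$. Each such step is called a cell: a cell contains $B$ if the current number $x$ is even (so $x \mapsto x/2$), and it contains $BA$ if the current number $x$ is odd (so $x \mapsto (3x+1)/2$). $C_n(L)$ denotes the chain consisting of the first $n$ cells starting from $L$, so it contains exactly $n$ functions $B$. Two chains are identical if they consist of the same sequence of cells. *)

theory Defs
  imports Main
begin

definition fun_A :: "nat \<Rightarrow> nat" where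
  "fun_A x = 3 * x + 1"

text \<open>Truncating division agrees with $x/2$ here, because the Collatz rule applies
  this function to even numbers only.\<close>

definition fun_B :: "nat \<Rightarrow> nat" where
  "fun_B x = x div 2"

text \<open>The cell \<open>Cell_BA\<close> is written as a composition: first $A$, then $B$.\<close>

datatype cell = Cell_B | Cell_BA

fun apply_cell :: "cell \<Rightarrow> nat \<Rightarrow> nat" where
  "apply_cell Cell_B = fun_B"
| "apply_cell Cell_BA = fun_B \<circ> fun_A"

definition cell_of :: "nat \<Rightarrow> cell" where
  "cell_of x = (if even x then Cell_B else Cell_BA)"

text \<open>\<open>collatz_chain n L\<close> is $C_n(L)$. It records only the cells and not the numbers visited, so that
  two chains are identical exactly when they are equal as lists.\<close>

fun collatz_chain :: "nat \<Rightarrow> nat \<Rightarrow> cell list" where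
  "collatz_chain 0 L = []"
| "collatz_chain (Suc n) L = cell_of L # collatz_chain n (apply_cell (cell_of L) L)"

end

(* Equal chains of length n force congruence modulo 2^n: both kinds of cell halve the difference
   of two numbers, up to the odd factor 3 for BA. The interval has length 2^n. *)
theory Submission
  imports Defs
begin

text \<open>The chain determines its start modulo \<open>2 ^ n\<close>
  (\<open>collatz_chain_eq_imp_dvd\<close>), by induction: the first cell gives the parity r, and
  for L = 2a + r, M = 2b + r the next numbers differ by a - b or 3(a - b). As 3 is invertible modulo
  \<open>2 ^ n\<close>, the remaining cells give \<open>2 ^ n\<close> dividing a - b, hence
  \<open>2 ^ Suc n\<close> dividing L - M. Distinct members of the interval are too close for
  this.\<close>

lemma collatz_chain_eq_imp_dvd:
  "collatz_chain n L = collatz_chain n M \<Longrightarrow> 2 ^ n dvd int L - int M"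
proof (induction n arbitrary: L M)
  case 0
  then show ?case by simp
next
  case (Suc n)
  have parity: "even L \<longleftrightarrow> even M"
    using Suc.prems by (auto simp: cell_of_def split: if_splits)
  have IH: "2 ^ n dvd int (apply_cell (cell_of L) L) - int (apply_cell (cell_of M) M)"
    using Suc.prems unfolding collatz_chain.simps list.inject by (blast intro: Suc.IH)
  \<comment> \<open>Both parities reduce to the halves \<open>a\<close> and \<open>b\<close>: equal
    remainders cancel, and the factor 2 supplies the extra power.\<close>
  have "\<exists>a b. int L - int M = 2 * (int a - int b) \<and> 2 ^ n dvd int a - int b"
  proof (cases "even L")
    case True
    then obtain a b where "L = 2 * a" "M = 2 * b"
      using parity by (metis evenE)
    with IH have "int L - int M = 2 * (int a - int b)" "2 ^ n dvd int a - int b"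
      by (simp_all add: cell_of_def fun_B_def)
    then show ?thesis by blast
  next
    case False
    then obtain a b where ab: "L = 2 * a + 1" "M = 2 * b + 1"
      using parity by (metis oddE)
    \<comment> \<open>(3(2k + 1) + 1)/2 = 3k + 2; the constant 2 cancels in the difference.\<close>
    have step: "apply_cell (cell_of (2 * k + 1)) (2 * k + 1) = 3 * k + 2" for k
      by (simp add: cell_of_def fun_A_def fun_B_def)
    have "2 ^ n dvd 3 * (int a - int b)"
      using IH unfolding ab step by (simp add: algebra_simps)
    moreover have "coprime (2 ^ n) (3 :: int)"
      by simp
    ultimately have "2 ^ n dvd int a - int b"
      using coprime_dvd_mult_right_iff by blast
    moreover have "int L - int M = 2 * (int a - int b)"
      using ab by simp
    ultimately show ?thesis by blast
  qed
  then show ?case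
    by (metis mult_dvd_mono dvd_refl power_Suc)
qed

theorem theorem2p2:
  fixes n L M :: nat
  assumes "n > 0"
    and "L \<in> {2 ^ n + 1..2 ^ (n + 1)}" and "odd L"
    and "M \<in> {2 ^ n + 1..2 ^ (n + 1)}" and "odd M"
    and "L \<noteq> M"
  shows "collatz_chain n L \<noteq> collatz_chain n M"
proof
  assume "collatz_chain n L = collatz_chain n M"
  then have "2 ^ n dvd int L - int M"
    by (rule collatz_chain_eq_imp_dvd)
  moreover have "int L - int M \<noteq> 0"
    using assms by simp
  ultimately have "\<bar>2 ^ n\<bar> \<le> \<bar>int L - int M\<bar>"
    by (intro dvd_imp_le_int)
  moreover have "\<bar>int L - int M\<bar> < int (2 ^ n)"
  proof -
    \<comment> \<open>The endpoints of the interval are only \<open>2 ^ n - 1\<close> apart.\<close>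
    have "L < M + 2 ^ n" "M < L + 2 ^ n"
      using assms(2,4) by simp_all
    then have "int L < int (M + 2 ^ n)" "int M < int (L + 2 ^ n)"
      by (simp_all only: of_nat_less_iff)
    then show ?thesis
      unfolding of_nat_add by linarith
  qed
  ultimately show False by simp
qed

end
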